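(* The canonical basis $\beta_0=(e_1,\ldots,e_n)$ of $\mathbb{C}^n$ can be turned into any other basis $\beta=(v_1,\ldots,v_n)$ of $\mathbb{C}^n$ via a finite sequence of elementary complex transformations (complex shears, complex line scalings, phase rotations, generalized complex line reflections, complex transpositions and generalized complex plane rotations), and $\arg(\det M(v_1,\ldots,v_n))$ is the total phase rotation used, modulo $2\pi$, where the total phase rotation is the sum of the angles $\varphi$ of all phase rotations used, plus $\pi$ for each use of a generalized complex line reflection or a complex transposition. Here $M(v_1,\ldots,v_n)$ is the $n\times n$ matrix with columns $v_1,\ldots,v_n$.
   Context: Bases are ordered. Let $p=n$ and $V=\mathbb{C}^n$. A transformation $S\in GL(V)$ that maps some basis $(w_1,w_2,\ldots,w_p)$ of $V$ to: (a) $(w_1+u,w_2,\ldots,w_p)$, for $u\in\operatorname{span}_{\mathbb{C}}\{w_2,\ldots,w_p\}$, is a complex shear; (b) $(cw_1,w_2,\ldots,w_p)$, for real $c>0$, is a complex line scaling; (c) $(e^{\mathrm{i}\varphi}w_1,w_2,\ldots,w_p)$, for $\varphi\in[0,2\pi)$, is a phase rotation (by $\varphi$); (d) $(-w_1,w_2,\ldots,w_p)$, is a generalized complex line reflection; (e) $(w_2,w_1,w_3,\ldots,w_p)$, is a complex transposition; (f) $(w_1\cos\theta+w_2\sin\theta,\,-w_1\sin\theta+w_2\cos\theta,\,w_3,\ldots,w_p)$, for $\theta\in[0,2\pi)$, is a generalized complex plane rotation. *)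

theory Defs
  imports "HOL-Analysis.Analysis" "HOL-Library.Real_Mod"
begin

text \<open>
  The type \<^typ>\<open>complex ^ 'n\<close> plays the role of the n-dimensional complex space, with n the cardinality of
  the (nonempty, finite) index type. An ordered basis is a family indexed by that type, so that the
  i-th vector of one basis is matched with the i-th vector of another.
\<close>

definition ordered_basis :: "('n::finite \<Rightarrow> complex ^ 'n) \<Rightarrow> bool" where
  "ordered_basis w \<longleftrightarrow>
     inj w \<and> vec.independent (range w) \<and> vec.span (range w) = UNIV"

definition canonical_basis :: "'n::finite \<Rightarrow> complex ^ 'n" where
  "canonical_basis i = axis i 1"

definition column_matrix :: "('n::finite \<Rightarrow> complex ^ 'n) \<Rightarrow> complex ^ 'n ^ 'n" where
  "column_matrix v = (\<chi> i j. v j $ i)"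

definition GL :: "(complex ^ 'n \<Rightarrow> complex ^ 'n::finite) set" where
  "GL = {S. Vector_Spaces.linear (*s) (*s) S \<and> bij S}"

text \<open>
  The index type carries no order. In the definitions below the index k is the position that is
  usually numbered 1, and l the one numbered 2; since the basis w is existentially quantified, the
  choice of k and l only fixes the order in which its members are listed.
\<close>

definition complex_shear :: "(complex ^ 'n \<Rightarrow> complex ^ 'n::finite) \<Rightarrow> bool" where
  "complex_shear S \<longleftrightarrow> S \<in> GL \<and>
     (\<exists>w k u. ordered_basis w \<and> u \<in> vec.span (w ` (UNIV - {k})) \<and>
        S \<circ> w = w(k := w k + u))"

definition complex_line_scaling :: "(complex ^ 'n \<Rightarrow> complex ^ 'n::finite) \<Rightarrow> bool" where
  "complex_line_scaling S \<longleftrightarrow> S \<in> GL \<and>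
     (\<exists>w k (c::real). ordered_basis w \<and> c > 0 \<and>
        S \<circ> w = w(k := complex_of_real c *s w k))"

definition phase_rotation :: "real \<Rightarrow> (complex ^ 'n \<Rightarrow> complex ^ 'n::finite) \<Rightarrow> bool" where
  "phase_rotation \<phi> S \<longleftrightarrow> S \<in> GL \<and> \<phi> \<in> {0..<2 * pi} \<and>
     (\<exists>w k. ordered_basis w \<and> S \<circ> w = w(k := exp (\<i> * complex_of_real \<phi>) *s w k))"

definition complex_line_reflection :: "(complex ^ 'n \<Rightarrow> complex ^ 'n::finite) \<Rightarrow> bool" where
  "complex_line_reflection S \<longleftrightarrow> S \<in> GL \<and>
     (\<exists>w k. ordered_basis w \<and> S \<circ> w = w(k := - w k))"

definition complex_transposition :: "(complex ^ 'n \<Rightarrow> complex ^ 'n::finite) \<Rightarrow> bool" where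
  "complex_transposition S \<longleftrightarrow> S \<in> GL \<and>
     (\<exists>w k l. ordered_basis w \<and> k \<noteq> l \<and> S \<circ> w = w(k := w l, l := w k))"

definition complex_plane_rotation :: "(complex ^ 'n \<Rightarrow> complex ^ 'n::finite) \<Rightarrow> bool" where
  "complex_plane_rotation S \<longleftrightarrow> S \<in> GL \<and>
     (\<exists>w k l \<theta>. ordered_basis w \<and> k \<noteq> l \<and> \<theta> \<in> {0..<2 * pi} \<and>
        S \<circ> w = w(k := complex_of_real (cos \<theta>) *s w k + complex_of_real (sin \<theta>) *s w l,
                  l := - complex_of_real (sin \<theta>) *s w k + complex_of_real (cos \<theta>) *s w l))"

text \<open>
  One map can be elementary in several ways (a phase rotation by \<^term>\<open>pi\<close> is also a line reflection,
  the identity is also a shear), so each step of a sequence records the way in which it is used.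
\<close>

datatype kind =
    Shear
  | Line_Scaling
  | Phase_Rotation real
  | Line_Reflection
  | Transposition
  | Plane_Rotation

fun elementary :: "kind \<Rightarrow> (complex ^ 'n \<Rightarrow> complex ^ 'n::finite) \<Rightarrow> bool" where
  "elementary Shear S = complex_shear S"
| "elementary Line_Scaling S = complex_line_scaling S"
| "elementary (Phase_Rotation \<phi>) S = phase_rotation \<phi> S"
| "elementary Line_Reflection S = complex_line_reflection S"
| "elementary Transposition S = complex_transposition S"
| "elementary Plane_Rotation S = complex_plane_rotation S"

fun phase :: "kind \<Rightarrow> real" where
  "phase (Phase_Rotation \<phi>) = \<phi>"
| "phase Line_Reflection = pi"
| "phase Transposition = pi"
| "phase Shear = 0"
| "phase Line_Scaling = 0"
| "phase Plane_Rotation = 0"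

type_synonym 'n step = "kind \<times> (complex ^ 'n \<Rightarrow> complex ^ 'n)"

definition total_phase_rotation :: "'n::finite step list \<Rightarrow> real" where
  "total_phase_rotation steps = (\<Sum>(k, S)\<leftarrow>steps. phase k)"

text \<open>The head of the list is applied first.\<close>

definition turns_into ::
  "'n::finite step list \<Rightarrow> ('n \<Rightarrow> complex ^ 'n) \<Rightarrow> ('n \<Rightarrow> complex ^ 'n) \<Rightarrow> bool" where
  "turns_into steps w v \<longleftrightarrow>
     (\<forall>(k, S) \<in> set steps. elementary k S) \<and> (\<forall>i. fold snd steps (w i) = v i)"

end

theory Submission
  imports Defs
begin

text \<open>
  The determinant carries the phase. If a linear map \<open>S\<close> sends a basis \<open>w\<close> to a basis \<open>w'\<close>, then
  \<open>det S\<close> is the quotient of the determinants of \<open>w'\<close> and \<open>w\<close>, so it can be read off from whichever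
  basis exhibits \<open>S\<close> as elementary: it is \<open>1\<close> for shears and plane rotations, positive for line
  scalings, \<open>e\<^sup>i\<^sup>\<phi>\<close> for phase rotations, and \<open>-1\<close> for line reflections and transpositions. In every
  case it is a positive real times \<open>e\<^sup>i\<^sup>\<psi>\<close>, where \<open>\<psi>\<close> is the phase that the step is charged
  (\<open>det_elementary\<close>). Since the canonical basis has determinant \<open>1\<close>, multiplying along a sequence
  shows that \<open>det M(v\<^sub>1,\<dots>,v\<^sub>n)\<close> is a positive real times \<open>e\<^sup>i\<^sup>t\<close> with \<open>t\<close> the total phase rotation
  (\<open>det_turns_into\<close>).

  Existence is a Steinitz exchange. Suppose that the current basis \<open>w\<close> already agrees with the target
  \<open>v\<close> at the indices in \<open>A\<close>, and let \<open>k\<close> be a further index. In the expansion of \<open>v k\<close> in the basis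
  \<open>w\<close> some \<open>w i\<close> with \<open>i \<notin> A\<close> has a nonzero coefficient, as \<open>v k\<close> would otherwise depend on the
  other members of \<open>v\<close>. A transposition brings that vector to position \<open>k\<close>, a line scaling and a phase
  rotation multiply it by its coefficient in polar form, and a shear adds the remaining terms
  (\<open>reachable_exchange\<close>). Each move changes the basis into one with nonzero determinant, hence into
  another basis, and the unique linear map that realises it is an elementary transformation.
\<close>

section \<open>The determinant of a family of vectors\<close>

lemma det_column_matrix: "det (column_matrix w) = det (\<chi> i. w i)"
proof -
  have "column_matrix w = transpose (\<chi> i. w i)"
    by (simp add: column_matrix_def transpose_def vec_eq_iff)
  then show ?thesis by simp
qed

lemma det_column_matrix_add:
  "det (column_matrix (w(k := a + b))) =
     det (column_matrix (w(k := a))) + det (column_matrix (w(k := b)))"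
  using det_row_add[of k "\<lambda>_. a" "\<lambda>_. b" w]
  by (simp add: det_column_matrix fun_upd_def)

lemma det_column_matrix_scale:
  "det (column_matrix (w(k := c *s a))) = c * det (column_matrix (w(k := a)))"
  using det_row_mul[of k c "\<lambda>_. a" w]
  by (simp add: det_column_matrix fun_upd_def)

lemma det_column_matrix_repeated:
  assumes "k \<noteq> l" "w k = w l"
  shows "det (column_matrix w) = 0"
  using assms by (intro det_identical_columns[of k l]) (simp_all add: column_def column_matrix_def)

lemma det_column_matrix_shear:
  assumes "u \<in> vec.span (w ` (UNIV - {k}))"
  shows "det (column_matrix (w(k := w k + u))) = det (column_matrix w)"
proof -
  have *: "w ` (UNIV - {k}) = {row j (\<chi> i. w i) |j. j \<noteq> k}"
    by (auto simp: row_def)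
  show ?thesis
    using det_row_span[where x = u and i = k and A = "\<chi> i. w i"] assms
    unfolding * det_column_matrix
    by (simp add: row_def fun_upd_def cong: if_cong)
qed

text \<open>
  Mixing two members multiplies the determinant by that of the two-by-two coefficient matrix, because
  the determinant is an alternating bilinear function of these two members. Transpositions and plane
  rotations are both instances.
\<close>

lemma det_column_matrix_two_by_two:
  assumes "k \<noteq> l"
  shows "det (column_matrix (w(k := a *s w k + b *s w l, l := c *s w k + d *s w l))) =
           (a * d - b * c) * det (column_matrix w)"
proof -
  define F where "F x y = det (column_matrix (w(k := x, l := y)))" for x y
  have r: "F x (y + z) = F x y + F x z" "F x (e *s y) = e * F x y" for x y z e
    unfolding F_def by (rule det_column_matrix_add, rule det_column_matrix_scale)
  have l: "F (y + z) x = F y x + F z x" "F (e *s y) x = e * F y x" for x y z e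
    unfolding F_def fun_upd_twist[OF assms]
    by (rule det_column_matrix_add, rule det_column_matrix_scale)
  have alt: "F x x = 0" for x
    unfolding F_def using assms by (intro det_column_matrix_repeated[of k l]) simp_all
  have "F (x + y) (x + y) = F x x + F y x + (F x y + F y y)" for x y
    by (simp only: r l)
  \<comment> \<open>The left-hand side and both squares vanish, which is the usual polarisation argument.\<close>
  then have anti: "F y x = - F x y" for x y
    by (simp add: alt eq_neg_iff_add_eq_0)
  have "F (a *s w k + b *s w l) (c *s w k + d *s w l) = (a * d - b * c) * F (w k) (w l)"
    by (simp add: r l alt anti[of "w l" "w k"] algebra_simps)
  then show ?thesis by (simp add: F_def)
qed

lemma det_column_matrix_linear:
  assumes "Vector_Spaces.linear (*s) (*s) S"
  shows "det (column_matrix (S \<circ> w)) = det (matrix S) * det (column_matrix w)"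
proof -
  have "column_matrix (S \<circ> w) $ i $ j = (matrix S ** column_matrix w) $ i $ j" for i j
  proof -
    have "column_matrix (S \<circ> w) $ i $ j = (matrix S *v w j) $ i"
      by (simp add: column_matrix_def matrix_works[OF assms])
    then show ?thesis
      by (simp add: column_matrix_def matrix_vector_mult_def matrix_matrix_mult_def)
  qed
  then have "column_matrix (S \<circ> w) = matrix S ** column_matrix w"
    by (simp add: vec_eq_iff)
  then show ?thesis by (simp add: det_mul)
qed

lemma det_canonical_basis:
  "det (column_matrix (canonical_basis :: 'n::finite \<Rightarrow> complex ^ 'n)) = 1"
proof -
  have "column_matrix (canonical_basis :: 'n \<Rightarrow> complex ^ 'n) = mat 1"
    by (simp add: column_matrix_def canonical_basis_def mat_def axis_def vec_eq_iff)
  then show ?thesis by simp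
qed

text \<open>
  This reduces every later proof that a modified family is still a basis to a determinant computation.
  A spanning family of \<open>n\<close> vectors in dimension \<open>n\<close> has no repetition and no dependence, so only the
  spanning condition has to be compared with the determinant.
\<close>

lemma ordered_basis_iff_det: "ordered_basis w \<longleftrightarrow> det (column_matrix w) \<noteq> 0"
proof -
  have rows: "rows (\<chi> i. w i) = range w"
    by (auto simp: rows_def row_def)
  have "det (column_matrix w) \<noteq> 0 \<longleftrightarrow> vec.span (range w) = UNIV"
    unfolding det_column_matrix
    by (metis rows invertible_det_nz invertible_left_inverse matrix_left_invertible_span_rows_gen)
  moreover have "ordered_basis w" if span: "vec.span (range w) = UNIV"
  proof -
    have "CARD('a) \<le> card (range w)"
      using vec.dim_le_card[of UNIV "range w"] span
      by (simp add: vec_dim_card del: vec.dim_UNIV)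
    then have card: "card (range w) = CARD('a)"
      using card_image_le[of UNIV w] by simp
    then have "inj w" by (simp add: eq_card_imp_inj_on)
    moreover have "vec.independent (range w)"
      using vec.card_le_dim_spanning[of "range w" UNIV] span card
      by (simp add: vec_dim_card del: vec.dim_UNIV)
    ultimately show ?thesis using span by (simp add: ordered_basis_def)
  qed
  ultimately show ?thesis by (auto simp: ordered_basis_def)
qed

section \<open>The phase of a sequence of elementary transformations\<close>

text \<open>
  The basis in which \<open>S\<close> looks elementary is arbitrary and varies from step to step; the determinant
  of \<open>S\<close> does not depend on it, which is what makes the phases of different steps comparable.
\<close>

lemma det_elementary:
  assumes "elementary K S"
  shows "\<exists>r>0. det (matrix S) = rcis r (phase K)"
proof -
  have ratio: "det (matrix S) = d"
    if "S \<in> GL" "ordered_basis w" "S \<circ> w = w'"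
      "det (column_matrix w') = d * det (column_matrix w)" for w w' d
    using that det_column_matrix_linear[of S w] by (simp add: GL_def ordered_basis_iff_det)
  show ?thesis
  proof (cases K)
    case Shear
    then obtain w k u where *: "S \<in> GL" "ordered_basis w" "u \<in> vec.span (w ` (UNIV - {k}))"
      "S \<circ> w = w(k := w k + u)"
      using assms by (auto simp: complex_shear_def)
    have "det (matrix S) = 1"
      by (rule ratio[OF *(1,2,4)]) (simp add: det_column_matrix_shear[OF *(3)])
    then show ?thesis using Shear by (intro exI[of _ 1]) (simp add: rcis_def)
  next
    case Line_Scaling
    then obtain w k c where *: "S \<in> GL" "ordered_basis w" "c > 0"
      "S \<circ> w = w(k := complex_of_real c *s w k)"
      using assms by (auto simp: complex_line_scaling_def)
    have "det (matrix S) = of_real c"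
      by (rule ratio[OF *(1,2,4)]) (simp add: det_column_matrix_scale)
    then show ?thesis using Line_Scaling *(3) by (intro exI[of _ c]) (simp add: rcis_def)
  next
    case (Phase_Rotation \<phi>)
    then obtain w k where *: "S \<in> GL" "ordered_basis w"
      "S \<circ> w = w(k := exp (\<i> * complex_of_real \<phi>) *s w k)"
      using assms by (auto simp: phase_rotation_def)
    have "det (matrix S) = exp (\<i> * complex_of_real \<phi>)"
      by (rule ratio[OF *]) (simp add: det_column_matrix_scale)
    then show ?thesis
      using Phase_Rotation by (intro exI[of _ 1]) (simp add: rcis_def cis_conv_exp)
  next
    case Line_Reflection
    then obtain w k where *: "S \<in> GL" "ordered_basis w" "S \<circ> w = w(k := - w k)"
      using assms by (auto simp: complex_line_reflection_def)
    have "det (matrix S) = -1"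
      by (rule ratio[OF *]) (use det_column_matrix_scale[of w k "-1" "w k"] in simp)
    then show ?thesis using Line_Reflection by (intro exI[of _ 1]) (simp add: rcis_def)
  next
    case Transposition
    then obtain w k l where *: "S \<in> GL" "ordered_basis w" "k \<noteq> l"
      "S \<circ> w = w(k := w l, l := w k)"
      using assms by (auto simp: complex_transposition_def)
    have "det (matrix S) = -1"
      by (rule ratio[OF *(1,2,4)])
        (use det_column_matrix_two_by_two[OF *(3), of w 0 1 1 0] in simp)
    then show ?thesis using Transposition by (intro exI[of _ 1]) (simp add: rcis_def)
  next
    case Plane_Rotation
    then obtain w k l \<theta> where *: "S \<in> GL" "ordered_basis w" "k \<noteq> l"
      "S \<circ> w = w(k := complex_of_real (cos \<theta>) *s w k + complex_of_real (sin \<theta>) *s w l,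
                  l := - complex_of_real (sin \<theta>) *s w k + complex_of_real (cos \<theta>) *s w l)"
      using assms by (auto simp: complex_plane_rotation_def)
    have "complex_of_real (cos \<theta>) * complex_of_real (cos \<theta>) +
        complex_of_real (sin \<theta>) * complex_of_real (sin \<theta>) = 1"
      by (simp flip: of_real_mult of_real_add)
    then have "det (matrix S) = 1"
      by (intro ratio[OF *(1,2,4)], subst det_column_matrix_two_by_two[OF *(3)]) simp
    then show ?thesis using Plane_Rotation by (intro exI[of _ 1]) (simp add: rcis_def)
  qed
qed

lemma elementary_in_GL: "elementary K S \<Longrightarrow> S \<in> GL"
  by (cases K) (auto simp: complex_shear_def complex_line_scaling_def phase_rotation_def
      complex_line_reflection_def complex_transposition_def complex_plane_rotation_def)

lemma turns_into_Nil: "turns_into [] w v \<longleftrightarrow> w = v"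
  by (auto simp: turns_into_def)

lemma turns_into_Cons:
  "turns_into ((K, S) # steps) w v \<longleftrightarrow> elementary K S \<and> turns_into steps (S \<circ> w) v"
  by (auto simp: turns_into_def)

lemma turns_into_append:
  "turns_into s w x \<Longrightarrow> turns_into t x v \<Longrightarrow> turns_into (s @ t) w v"
  by (auto simp: turns_into_def)

lemma det_turns_into:
  assumes "turns_into steps w v"
  shows "\<exists>r>0. det (column_matrix v) = rcis r (total_phase_rotation steps) * det (column_matrix w)"
  using assms
proof (induction steps arbitrary: w)
  case Nil
  then show ?case
    by (intro exI[of _ 1]) (simp add: turns_into_Nil total_phase_rotation_def rcis_def)
next
  case (Cons s steps)
  obtain K S where s: "s = (K, S)" by (cases s)
  with Cons.prems have el: "elementary K S" and "turns_into steps (S \<circ> w) v"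
    by (simp_all add: turns_into_Cons)
  from Cons.IH[OF this(2)] obtain r where r: "r > 0"
    "det (column_matrix v) = rcis r (total_phase_rotation steps) * det (column_matrix (S \<circ> w))"
    by blast
  from det_elementary[OF el] obtain q where q: "q > 0" "det (matrix S) = rcis q (phase K)"
    by blast
  have "det (column_matrix (S \<circ> w)) = rcis q (phase K) * det (column_matrix w)"
    using det_column_matrix_linear[of S w] elementary_in_GL[OF el] q(2) by (simp add: GL_def)
  then have "det (column_matrix v) =
      rcis (r * q) (total_phase_rotation (s # steps)) * det (column_matrix w)"
    by (simp add: r(2) s total_phase_rotation_def mult.assoc[symmetric] rcis_mult add.commute)
  then show ?case using r(1) q(1) by (intro exI[of _ "r * q"]) simp
qed

lemma Arg_rcis_rcong:
  assumes "r > 0"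
  shows "[Arg (rcis r t) = t] (rmod (2 * pi))"
proof -
  have "rcis r (Arg (rcis r t)) = rcis r t"
    using rcis_cmod_Arg[of "rcis r t"] assms by simp
  then have "cis (Arg (rcis r t)) = cis t"
    using assms by (simp add: rcis_def)
  then have "exp (\<i> * complex_of_real (Arg (rcis r t))) = exp (\<i> * complex_of_real t)"
    by (simp add: cis_conv_exp)
  then obtain n where "\<i> * complex_of_real (Arg (rcis r t)) = 
      \<i> * complex_of_real t + (of_int (2 * n) * pi) * \<i>"
    unfolding exp_eq by blast
  then have "t = Arg (rcis r t) + of_int (- n) * (2 * pi)"
    by (simp add: complex_eq_iff)
  then show ?thesis unfolding rcong_altdef by blast
qed

section \<open>Reaching an arbitrary basis\<close>

lemma basis_map_exists:
  assumes "ordered_basis w" "ordered_basis w'"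
  obtains S where "S \<in> GL" "S \<circ> w = w'"
proof -
  have inj: "inj w" and ind: "vec.independent (range w)"
    using assms(1) by (simp_all add: ordered_basis_def)
  obtain S where lin: "Vector_Spaces.linear (*s) (*s) S" and "\<forall>x\<in>range w. S x = (w' \<circ> inv w) x"
    using vec.linear_independent_extend[OF ind] by blast
  then have Sw: "S \<circ> w = w'" using inj by (auto simp: fun_eq_iff)
  have "det (matrix S) \<noteq> 0"
    using det_column_matrix_linear[OF lin, of w] Sw assms by (auto simp: ordered_basis_iff_det)
  then have "inj S" using det_nz_iff_inj_gen[OF lin] by simp
  then have "bij S" using vec.linear_inj_imp_surj[OF lin] by (simp add: bij_def)
  then show thesis using that lin Sw by (simp add: GL_def)
qed

text \<open>
  The condition on the target makes the relation compose: the lemmas below need their starting family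
  to be a basis, and that is what the preceding move provides.
\<close>

definition reachable :: "('n::finite \<Rightarrow> complex ^ 'n) \<Rightarrow> ('n \<Rightarrow> complex ^ 'n) \<Rightarrow> bool" where
  "reachable w v \<longleftrightarrow> ordered_basis v \<and> (\<exists>steps. turns_into steps w v)"

lemma reachable_trans: "reachable w x \<Longrightarrow> reachable x v \<Longrightarrow> reachable w v"
  unfolding reachable_def by (metis turns_into_append)

text \<open>
  Elementary transformations are specified by their effect on a basis, so a change of basis of the
  right shape is realised by an elementary transformation as soon as both families are bases. In every
  use the witness for the defining existential is the current basis \<open>w\<close> itself.
\<close>

lemma reachable_step:
  assumes "ordered_basis w" "ordered_basis w'"
    and "\<And>S. S \<in> GL \<Longrightarrow> S \<circ> w = w' \<Longrightarrow> elementary K S"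
  shows "reachable w w'"
proof -
  obtain S where "S \<in> GL" "S \<circ> w = w'" using basis_map_exists[OF assms(1,2)] .
  then have "turns_into [(K, S)] w w'" using assms(3) by (simp add: turns_into_Cons turns_into_Nil)
  then show ?thesis using assms(2) by (auto simp: reachable_def)
qed

lemma reachable_shear:
  assumes "ordered_basis w" "u \<in> vec.span (w ` (UNIV - {k}))"
  shows "reachable w (w(k := w k + u))"
  using assms by (intro reachable_step[where K = Shear])
    (auto simp: ordered_basis_iff_det det_column_matrix_shear complex_shear_def)

lemma reachable_swap:
  assumes "ordered_basis w"
  shows "reachable w (w(k := w l, l := w k))"
proof (cases "k = l")
  case True
  then show ?thesis using assms turns_into_Nil[of w w] by (auto simp: reachable_def)
next
  case False
  have "ordered_basis (w(k := w l, l := w k))"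
    using assms det_column_matrix_two_by_two[OF False, of w 0 1 1 0]
    by (simp add: ordered_basis_iff_det)
  with False assms show ?thesis
    by (intro reachable_step[where K = Transposition]) (auto simp: complex_transposition_def)
qed

text \<open>
  Writing \<open>c\<close> in polar form splits the multiplication into a line scaling by the modulus and a phase
  rotation by the argument in \<open>[0, 2\<pi>)\<close>.
\<close>

lemma reachable_scale:
  assumes w: "ordered_basis w" and "c \<noteq> 0"
  shows "reachable w (w(k := c *s w k))"
proof -
  have basis: "ordered_basis (x(k := d *s x k))" if "ordered_basis x" "d \<noteq> 0" for x d
    using that by (simp add: ordered_basis_iff_det det_column_matrix_scale)
  define x where "x = w(k := complex_of_real (cmod c) *s w k)"
  define \<phi> where "\<phi> = Arg2pi c"
  have \<phi>: "\<phi> \<in> {0..<2 * pi}" using Arg2pi[of c] by (simp add: \<phi>_def)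
  have polar: "c = exp (\<i> * complex_of_real \<phi>) * complex_of_real (cmod c)"
    using Arg2pi_eq[of c] by (simp add: \<phi>_def mult.commute)
  have x: "ordered_basis x" unfolding x_def using assms by (intro basis) simp_all
  have "reachable w x"
    using w x assms(2) unfolding x_def
    by (intro reachable_step[where K = Line_Scaling])
      (auto simp: complex_line_scaling_def intro!: exI[of _ w] exI[of _ k] exI[of _ "cmod c"])
  moreover have "reachable x (x(k := exp (\<i> * complex_of_real \<phi>) *s x k))"
    using x basis[OF x, of "exp (\<i> * complex_of_real \<phi>)"] \<phi>
    by (intro reachable_step[where K = "Phase_Rotation \<phi>"]) (auto simp: phase_rotation_def)
  moreover have "x(k := exp (\<i> * complex_of_real \<phi>) *s x k) = w(k := c *s w k)"
    using polar by (simp add: x_def vector_smult_assoc)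
  ultimately show ?thesis using reachable_trans by metis
qed

lemma reachable_replace:
  assumes "ordered_basis w" "c \<noteq> 0" "u \<in> vec.span (w ` (UNIV - {k}))"
  shows "reachable w (w(k := c *s w k + u))"
proof -
  let ?x = "w(k := c *s w k)"
  have 1: "reachable w ?x" using assms by (intro reachable_scale)
  moreover have "?x ` (UNIV - {k}) = w ` (UNIV - {k})" by auto
  ultimately have "reachable ?x (?x(k := ?x k + u))"
    using assms(3) by (intro reachable_shear) (simp_all add: reachable_def)
  then show ?thesis using reachable_trans[OF 1] by simp
qed

text \<open>
  The exchange step. Choosing the coefficient outside \<open>A\<close> ensures that the transposition does not
  disturb the members that already agree with \<open>v\<close>; such a coefficient exists because \<open>v k\<close> is
  independent of the \<open>v j\<close> with \<open>j \<in> A\<close>.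
\<close>

lemma reachable_exchange:
  assumes w: "ordered_basis w" and v: "ordered_basis v"
    and agree: "\<And>i. i \<in> A \<Longrightarrow> w i = v i" and k: "k \<notin> A"
  obtains x where "reachable w x" "\<And>i. i \<in> insert k A \<Longrightarrow> x i = v i"
proof -
  have "v k \<in> vec.span (range w)" using w by (simp add: ordered_basis_def)
  then obtain b where "v k = (\<Sum>x\<in>range w. b x *s x)"
    by (auto simp: vec.span_finite)
  then obtain a where a: "v k = (\<Sum>i\<in>UNIV. a i *s w i)"
    using w by (simp add: sum.reindex ordered_basis_def o_def)
  have "\<exists>i. i \<notin> A \<and> a i \<noteq> 0"
  proof (rule ccontr)
    assume "\<not> ?thesis"
    then have "v k = (\<Sum>i\<in>A. a i *s w i)"
      unfolding a by (intro sum.mono_neutral_right) auto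
    also have "\<dots> = (\<Sum>i\<in>A. a i *s v i)" using agree by simp
    also have "\<dots> \<in> vec.span (v ` A)"
      by (intro vec.span_sum vec.span_scale vec.span_base imageI)
    also have "\<dots> \<subseteq> vec.span (range v - {v k})"
      using v k by (intro vec.span_mono) (auto simp: ordered_basis_def inj_def)
    finally show False
      using v unfolding ordered_basis_def vec.dependent_def by blast
  qed
  then obtain i where i: "i \<notin> A" "a i \<noteq> 0" by blast
  define u where "u = (\<Sum>j\<in>UNIV - {i}. a j *s w j)"
  have u: "u \<in> vec.span (w ` (UNIV - {i}))"
    unfolding u_def by (intro vec.span_sum vec.span_scale vec.span_base imageI)
  have vk: "v k = a i *s w i + u"
    unfolding a u_def by (simp add: sum.remove)
  define y where "y = w(k := w i, i := w k)"
  have wy: "reachable w y" unfolding y_def using w by (rule reachable_swap)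
  have yk: "y k = w i" by (simp add: y_def)
  \<comment> \<open>After the swap the remaining vectors are the same, only \<open>w k\<close> now sits at \<open>i\<close>.\<close>
  have "w ` (UNIV - {i}) \<subseteq> y ` (UNIV - {k})"
  proof
    fix z assume "z \<in> w ` (UNIV - {i})"
    then obtain j where "j \<noteq> i" "z = w j" by blast
    then show "z \<in> y ` (UNIV - {k})"
      by (cases "j = k") (auto simp: y_def intro: image_eqI[of _ _ i] image_eqI[of _ _ j])
  qed
  then have "u \<in> vec.span (y ` (UNIV - {k}))" using u vec.span_mono by blast
  then have "reachable y (y(k := a i *s y k + u))"
    using wy i(2) by (intro reachable_replace) (simp_all add: reachable_def)
  then have "reachable w (y(k := v k))" using reachable_trans[OF wy] by (simp add: yk vk)
  then show thesis
    using agree i(1) k by (intro that[of "y(k := v k)"]) (auto simp: y_def)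
qed

lemma reachable_basis:
  assumes w: "ordered_basis w" and v: "ordered_basis v"
  shows "reachable w v"
proof -
  have "\<exists>x. reachable w x \<and> (\<forall>i\<in>A. x i = v i)" for A :: "'a set"
    using finite[of A]
  proof (induction A)
    case empty
    then show ?case using w turns_into_Nil[of w w] by (auto simp: reachable_def)
  next
    case (insert k A)
    then obtain x where x: "reachable w x" "\<And>i. i \<in> A \<Longrightarrow> x i = v i" by blast
    then have "ordered_basis x" by (simp add: reachable_def)
    from reachable_exchange[OF this v x(2) insert.hyps(2)]
    obtain y where "reachable x y" "\<And>i. i \<in> insert k A \<Longrightarrow> y i = v i" by metis
    then show ?case using reachable_trans[OF x(1)] by blast
  qed
  from this[of UNIV] obtain x where "reachable w x" "\<forall>i. x i = v i" by auto
  moreover from this(2) have "x = v" by auto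
  ultimately show ?thesis by simp
qed

theorem theorem3p7:
  fixes v :: "'n::finite \<Rightarrow> complex ^ 'n"
  assumes "ordered_basis v"
  shows "(\<exists>steps. turns_into steps canonical_basis v) \<and>
         (\<forall>steps. turns_into steps canonical_basis v \<longrightarrow>
            [Arg (det (column_matrix v)) = total_phase_rotation steps] (rmod (2 * pi)))"
proof (intro conjI allI impI)
  have "ordered_basis canonical_basis"
    by (simp add: ordered_basis_iff_det det_canonical_basis)
  then show "\<exists>steps. turns_into steps canonical_basis v"
    using reachable_basis[OF _ assms] by (auto simp: reachable_def)
next
  fix steps :: "'n step list"
  assume "turns_into steps canonical_basis v"
  then obtain r where "r > 0" "det (column_matrix v) = rcis r (total_phase_rotation steps)"
    using det_turns_into[of steps canonical_basis v] by (auto simp: det_canonical_basis)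
  then show "[Arg (det (column_matrix v)) = total_phase_rotation steps] (rmod (2 * pi))"
    by (simp add: Arg_rcis_rcong)
qed

end
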